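(* Let $\mathcal{Y}$ be a finite set, $\mathcal{U}$ a Polish space, $\Theta\subseteq\mathbb{R}^{d_\theta}$ open, and $X$ a random element. For each value $x$ of $X$ let $P(\cdot\vert x)$ be the conditional distribution of the outcome $Y$ on $\mathcal{Y}$ given $X=x$, and for each $\theta\in\Theta$ let $\nu(\cdot\vert x;\theta)$ be a probability measure on $\mathcal{U}$ and $\epsilon\mapsto G(\epsilon\vert x;\theta)\subseteq\mathcal{Y}$ a measurable correspondence. Put $\mathcal{L}(B\vert x;\theta)=\nu(\{\epsilon: G(\epsilon\vert x;\theta)\cap B\ne\varnothing\}\vert x;\theta)$ for $B\subseteq\mathcal{Y}$. Let $\Theta_I$ be the set of $\theta\in\Theta$ for which there exists an equilibrium selection mechanism compatible with the data. Then $\Theta_I$ is obtained by minimization of a submodular set function: $$\Theta_I=\left\{\theta\in\Theta:\ \min_{B\subseteq\mathcal{Y}}\left(\mathcal{L}(B\vert X;\theta)-P(B\vert X)\right)=0,\ X\text{-a.s.}\right\},$$ where the set function $B\mapsto\mathcal{L}(B\vert X;\theta)-P(B\vert X)$ is submodular.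
   Context: Measurable correspondence: for almost all $x$ and all $\theta$, for every $A\subseteq\mathcal{Y}$ the set $\{\epsilon\in\mathcal{U}: G(\epsilon\vert x;\theta)\cap A\ne\varnothing\}$ is measurable. Equilibrium selection mechanism (at $\theta$): a conditional probability $\pi(\cdot\vert\epsilon,X)$ on $\mathcal{Y}$ given $(\epsilon,X)$ with support contained in $G(\epsilon\vert X;\theta)$, i.e. for almost every value $x$ of $X$ a probability kernel $\epsilon\mapsto\pi(\cdot\vert\epsilon,x)$ with $\pi(G(\epsilon\vert x;\theta)\vert\epsilon,x)=1$ for $\nu(\cdot\vert x;\theta)$-almost every $\epsilon$. It is compatible with the data if for almost every $x$ and all $A\subseteq\mathcal{Y}$, $P(A\vert x)=\int_{\mathcal{U}}\pi(A\vert\epsilon,x)\,\nu(d\epsilon\vert x;\theta)$. Existence is understood value by value of $X$. A set function $\varphi:2^{\mathcal{Y}}\to\mathbb{R}$ is submodular if $\varphi(A\cup B)+\varphi(A\cap B)\leq\varphi(A)+\varphi(B)$ for all $A,B\subseteq\mathcal{Y}$. *)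

theory Defs
  imports "HOL-Probability.Probability"
begin

text \<open>
  \<open>K\<close> is a (regular) conditional distribution of \<open>Y\<close> (with values in the measurable space \<open>T\<close>)
  given \<open>X\<close> (with values in \<open>S\<close>). Measurability into \<^const>\<open>prob_algebra\<close> says that \<open>K\<close> is a
  probability kernel.
\<close>

definition conditional_distribution ::
  "'w measure \<Rightarrow> 'x measure \<Rightarrow> ('w \<Rightarrow> 'x) \<Rightarrow> 'y measure \<Rightarrow> ('w \<Rightarrow> 'y) \<Rightarrow> ('x \<Rightarrow> 'y measure) \<Rightarrow> bool"
where
  "conditional_distribution M S X T Y K \<longleftrightarrow>
     K \<in> S \<rightarrow>\<^sub>M prob_algebra T \<and>
     (\<forall>C\<in>sets S. \<forall>B\<in>sets T.
        emeasure M {\<omega> \<in> space M. X \<omega> \<in> C \<and> Y \<omega> \<in> B} =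
        (\<integral>\<^sup>+x\<in>C. emeasure (K x) B \<partial>distr M S X))"

definition measurable_correspondence :: "('u::topological_space \<Rightarrow> 'y set) \<Rightarrow> bool" where
  "measurable_correspondence F \<longleftrightarrow> (\<forall>A. {\<epsilon>. F \<epsilon> \<inter> A \<noteq> {}} \<in> sets borel)"

definition submodular :: "('y set \<Rightarrow> real) \<Rightarrow> bool" where
  "submodular \<phi> \<longleftrightarrow> (\<forall>A B. \<phi> (A \<union> B) + \<phi> (A \<inter> B) \<le> \<phi> A + \<phi> B)"

text \<open>
  Throughout, \<open>G \<epsilon> x \<theta>\<close>, \<open>\<nu> x \<theta>\<close> and \<open>\<pi> x \<epsilon>\<close> stand for \<open>G(\<epsilon>|x;\<theta>)\<close>, \<open>\<nu>(\<cdot>|x;\<theta>)\<close> and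
  \<open>\<pi>(\<cdot>|\<epsilon>,x)\<close>, and \<open>\<mu>\<close> for the law of \<open>X\<close>.
\<close>

definition hitting_prob ::
  "('x \<Rightarrow> 'p \<Rightarrow> 'u measure) \<Rightarrow> ('u \<Rightarrow> 'x \<Rightarrow> 'p \<Rightarrow> 'y set) \<Rightarrow> 'x \<Rightarrow> 'p \<Rightarrow> 'y set \<Rightarrow> real"
where
  "hitting_prob \<nu> G x \<theta> B = measure (\<nu> x \<theta>) {\<epsilon>. G \<epsilon> x \<theta> \<inter> B \<noteq> {}}"

text \<open>
  Existence of selection mechanisms is understood value by value of \<open>x\<close>, so \<open>\<pi> x\<close> is a kernel
  in \<open>\<epsilon>\<close> for almost every \<open>x\<close>, without joint measurability in \<open>(\<epsilon>, x)\<close>.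
\<close>

definition equilibrium_selection_mechanism ::
  "'x measure \<Rightarrow> ('x \<Rightarrow> 'p \<Rightarrow> 'u::topological_space measure) \<Rightarrow> ('u \<Rightarrow> 'x \<Rightarrow> 'p \<Rightarrow> 'y set) \<Rightarrow>
   'p \<Rightarrow> ('x \<Rightarrow> 'u \<Rightarrow> 'y measure) \<Rightarrow> bool"
where
  "equilibrium_selection_mechanism \<mu> \<nu> G \<theta> \<pi> \<longleftrightarrow>
     (AE x in \<mu>. \<pi> x \<in> borel \<rightarrow>\<^sub>M prob_algebra (count_space UNIV) \<and>
        (AE \<epsilon> in \<nu> x \<theta>. measure (\<pi> x \<epsilon>) (G \<epsilon> x \<theta>) = 1))"

definition compatible_with_data ::
  "'x measure \<Rightarrow> ('x \<Rightarrow> 'y measure) \<Rightarrow> ('x \<Rightarrow> 'p \<Rightarrow> 'u measure) \<Rightarrow> 'p \<Rightarrow>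
   ('x \<Rightarrow> 'u \<Rightarrow> 'y measure) \<Rightarrow> bool"
where
  "compatible_with_data \<mu> P \<nu> \<theta> \<pi> \<longleftrightarrow>
     (AE x in \<mu>. \<forall>A. measure (P x) A = (\<integral>\<epsilon>. measure (\<pi> x \<epsilon>) A \<partial>\<nu> x \<theta>))"

definition identified_set ::
  "'x measure \<Rightarrow> ('x \<Rightarrow> 'y measure) \<Rightarrow> ('x \<Rightarrow> 'p \<Rightarrow> 'u::topological_space measure) \<Rightarrow>
   ('u \<Rightarrow> 'x \<Rightarrow> 'p \<Rightarrow> 'y set) \<Rightarrow> 'p set \<Rightarrow> 'p set"
where
  "identified_set \<mu> P \<nu> G \<Theta> =
     {\<theta> \<in> \<Theta>. \<exists>\<pi>. equilibrium_selection_mechanism \<mu> \<nu> G \<theta> \<pi> \<and> compatible_with_data \<mu> P \<nu> \<theta> \<pi>}"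

end

theory Submission
  imports Defs "HOL-Library.Set_Algebras"
begin

text \<open>
  Fix \<open>x\<close> and \<open>\<theta>\<close>. A selection from \<open>G\<close> charges \<open>B\<close> only where \<open>G\<close> hits \<open>B\<close>, so compatibility
  forces \<open>P \<le> \<L>\<close>, and the minimum, attained at \<open>B = {}\<close>, is \<open>0\<close>. Conversely, only the masses
  \<open>n D\<close> of the events \<open>{G = D}\<close> matter, and a selection amounts to writing \<open>P\<close> as a point of the
  Minkowski sum of the simplices over \<open>D\<close> scaled by \<open>n D\<close>. If \<open>P\<close> lay outside this compact
  convex set, a separating vector \<open>w\<close> would have a larger expectation under \<open>P\<close> than
  \<open>\<Sum>D. n D * Max (w ` D)\<close>, the Choquet integral of \<open>w\<close> with respect to \<open>\<L>\<close>; comparing upper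
  level sets of \<open>w\<close> shows that \<open>P \<le> \<L>\<close> excludes this.
\<close>

section \<open>Minkowski sums and separating hyperplanes\<close>

text \<open>Compactness, not just closedness, is carried through the induction because a sum of two
  closed sets need not be closed; the separation below uses a closed convex sum.\<close>

lemma compact_convex_set_sum:
  fixes C :: "'i \<Rightarrow> 'a::euclidean_space set"
  assumes "finite I" and "\<And>i. i \<in> I \<Longrightarrow> compact (C i) \<and> convex (C i)"
  shows "compact (\<Sum>i\<in>I. C i) \<and> convex (\<Sum>i\<in>I. C i)"
  using assms
proof (induction I rule: finite_induct)
  case empty
  then show ?case by (simp add: set_zero)
next
  case (insert i I)
  have "C i + (\<Sum>i\<in>I. C i) = {x + y |x y. x \<in> C i \<and> y \<in> (\<Sum>i\<in>I. C i)}"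
    by (auto simp: set_plus_def)
  with insert show ?case
    using compact_sums[of "C i" "\<Sum>i\<in>I. C i"] convex_set_plus[of "C i" "\<Sum>i\<in>I. C i"]
    by simp
qed

text \<open>A point outside the closed convex sum is strictly separated from it, and the point that
  \<open>sup\<close> supplies for the separating direction violates this. The witness form of
  \<open>sup\<close> lets each summand be maximized on its own.\<close>

lemma mem_set_sum_by_support:
  fixes C :: "'i \<Rightarrow> 'a::euclidean_space set"
  assumes fin: "finite I" and C: "\<And>i. i \<in> I \<Longrightarrow> compact (C i) \<and> convex (C i)"
    and sup: "\<And>w. \<exists>c. (\<forall>i\<in>I. c i \<in> C i) \<and> w \<bullet> p \<le> w \<bullet> (\<Sum>i\<in>I. c i)"
  shows "\<exists>c. (\<forall>i\<in>I. c i \<in> C i) \<and> p = (\<Sum>i\<in>I. c i)"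
proof (rule ccontr)
  assume "\<not> ?thesis"
  then have p: "p \<notin> (\<Sum>i\<in>I. C i)"
    using fin by (auto simp: set_sum_alt)
  have K: "convex (\<Sum>i\<in>I. C i)" "closed (\<Sum>i\<in>I. C i)"
    using compact_convex_set_sum[of I C, OF fin C] by (auto intro: compact_imp_closed)
  obtain a b where ab: "a \<bullet> p < b" "\<forall>x\<in>(\<Sum>i\<in>I. C i). b < a \<bullet> x"
    using separating_hyperplane_closed_point[OF K p] by auto
  \<comment> \<open>The separation puts \<open>p\<close> on the lower side of the hyperplane, so
    \<open>sup\<close> is used in direction \<open>- a\<close>.\<close>
  obtain c where c: "\<forall>i\<in>I. c i \<in> C i" "(- a) \<bullet> p \<le> (- a) \<bullet> (\<Sum>i\<in>I. c i)"
    using sup by blast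
  have "(\<Sum>i\<in>I. c i) \<in> (\<Sum>i\<in>I. C i)"
    using c(1) fin by (auto simp: set_sum_alt)
  with ab c(2) show False by fastforce
qed

section \<open>The Choquet integral bound\<close>

text \<open>
  Layer-cake: \<open>w y - c\<close> is the Lebesgue measure of \<open>{c..<w y}\<close>, and the hypothesis for the upper
  level set \<open>B = {y. t < w y}\<close> compares the two integrands at \<open>t\<close>.
\<close>
lemma expectation_le_Choquet:
  fixes p :: "'y::finite \<Rightarrow> real" and n :: "'y set \<Rightarrow> real"
  assumes dom: "\<And>B. sum p B \<le> (\<Sum>D | D \<inter> B \<noteq> {}. n D)"
    and tot: "sum p UNIV = (\<Sum>D | D \<noteq> {}. n D)"
  shows "(\<Sum>y\<in>UNIV. p y * w y) \<le> (\<Sum>D | D \<noteq> {}. n D * Max (w ` D))"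
proof -
  \<comment> \<open>Starting the layers at the minimum of \<open>w\<close> gives bounded intervals;
    by \<open>tot\<close> the resulting shift by \<open>c\<close> costs the same on both
    sides.\<close>
  define c where "c = Min (range w)"
  have cw: "c \<le> w y" for y by (simp add: c_def)
  have cm: "c \<le> Max (w ` D)" if D: "D \<noteq> {}" for D
  proof -
    from D obtain y where "y \<in> D" by auto
    then have "w y \<le> Max (w ` D)" by simp
    with cw[of y] show ?thesis by simp
  qed
  let ?f = "\<lambda>t. \<Sum>y\<in>UNIV. p y * indicator {c..<w y} t :: real"
  let ?g = "\<lambda>t. \<Sum>D | D \<noteq> {}. n D * indicator {c..<Max (w ` D)} t :: real"
  have "integral\<^sup>L lborel ?f \<le> integral\<^sup>L lborel ?g"
  proof (rule integral_mono)
    show "integrable lborel ?f"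
      using cw by (intro Bochner_Integration.integrable_sum integrable_mult_right)
        (simp add: integrable_indicator_iff)
    show "integrable lborel ?g"
      using cm by (intro Bochner_Integration.integrable_sum integrable_mult_right)
        (simp add: integrable_indicator_iff)
    fix t
    show "?f t \<le> ?g t"
    proof (cases "c \<le> t")
      case False
      then show ?thesis by (simp add: indicator_def)
    next
      case True
      have "?f t = (\<Sum>y\<in>UNIV. if t < w y then p y else 0)"
        using True by (intro sum.cong) (auto simp: indicator_def)
      also have "\<dots> = sum p {y. t < w y}"
        by (simp add: sum.If_cases)
      also have "\<dots> \<le> (\<Sum>D | D \<inter> {y. t < w y} \<noteq> {}. n D)"
        by (rule dom)
      \<comment> \<open>A set \<open>D\<close> meets the upper level set iff it is nonempty and the
        maximum of \<open>w\<close> on \<open>D\<close> exceeds \<open>t\<close>.\<close>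
      also have "\<dots> = (\<Sum>D | D \<noteq> {}. if t < Max (w ` D) then n D else 0)"
        by (auto simp: Max_gr_iff sum.If_cases intro!: sum.cong)
      also have "\<dots> = ?g t"
        using True by (intro sum.cong) (auto simp: indicator_def)
      finally show ?thesis .
    qed
  qed
  moreover have "integral\<^sup>L lborel ?f = (\<Sum>y\<in>UNIV. p y * (w y - c))"
    using cw by (subst Bochner_Integration.integral_sum)
      (auto simp: integrable_indicator_iff intro!: integrable_mult_right)
  moreover have "integral\<^sup>L lborel ?g = (\<Sum>D | D \<noteq> {}. n D * (Max (w ` D) - c))"
    using cm by (subst Bochner_Integration.integral_sum)
      (auto simp: integrable_indicator_iff intro!: integrable_mult_right)
  ultimately show ?thesis
    using tot by (simp add: algebra_simps sum_subtractf flip: sum_distrib_left)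
qed

section \<open>Splitting masses of sets into masses of points\<close>

lemma inner_vec_sum_mult:
  fixes w :: "real ^ 'y"
  shows "w \<bullet> v = (\<Sum>y\<in>UNIV. v $ y * w $ y)"
  by (simp add: inner_vec_def mult.commute)

text \<open>Lets a point of the hull be read as a probability vector carried by \<open>D\<close>:
  such vectors form a convex set that contains the vertices.\<close>

lemma hull_axis_subset_simplex:
  "convex hull ((\<lambda>y. axis y (1::real)) ` D) \<subseteq>
     {h. (\<forall>y. 0 \<le> h $ y) \<and> (\<Sum>y\<in>UNIV. h $ y) = 1 \<and> (\<forall>y. y \<notin> D \<longrightarrow> h $ y = 0)}"
proof (rule hull_minimal)
  show "convex {h :: real ^ 'a.
      (\<forall>y. 0 \<le> h $ y) \<and> (\<Sum>y\<in>UNIV. h $ y) = 1 \<and> (\<forall>y. y \<notin> D \<longrightarrow> h $ y = 0)}"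
    by (auto simp: convex_def sum.distrib simp flip: sum_distrib_left)
qed (auto simp: axis_def)

text \<open>A finite form of Artstein's theorem on selections of random sets: \<open>n D\<close> is
  the mass placed on the set \<open>D\<close>, and \<open>\<kappa> D\<close> tells how to split it
  among the points of \<open>D\<close>. The support condition for the Minkowski sum is
  \<open>expectation_le_Choquet\<close>.\<close>

lemma transport_pmf:
  fixes p :: "'y::finite \<Rightarrow> real" and n :: "'y set \<Rightarrow> real"
  assumes n: "\<And>D. 0 \<le> n D"
    and dom: "\<And>B. sum p B \<le> (\<Sum>D | D \<inter> B \<noteq> {}. n D)"
    and tot: "sum p UNIV = (\<Sum>D | D \<noteq> {}. n D)"
  obtains \<kappa> :: "'y set \<Rightarrow> 'y pmf"
  where "\<And>D. D \<noteq> {} \<Longrightarrow> set_pmf (\<kappa> D) \<subseteq> D"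
    and "\<And>y. p y = (\<Sum>D | D \<noteq> {}. n D * pmf (\<kappa> D) y)"
proof -
  define H where "H D = convex hull ((\<lambda>y. axis y (1::real)) ` D)" for D :: "'y set"
  have "\<exists>c. (\<forall>D\<in>{D. D \<noteq> {}}. c D \<in> (\<lambda>h. n D *\<^sub>R h) ` H D) \<and> (\<chi> y. p y) = (\<Sum>D | D \<noteq> {}. c D)"
  proof (rule mem_set_sum_by_support)
    fix D :: "'y set"
    have "compact (H D)" unfolding H_def
      by (intro compact_convex_hull finite_imp_compact) simp
    then show "compact ((\<lambda>h. n D *\<^sub>R h) ` H D) \<and> convex ((\<lambda>h. n D *\<^sub>R h) ` H D)"
      by (simp add: compact_scaling convex_scaling H_def)
  next
    fix w :: "real ^ 'y"
    \<comment> \<open>A maximizer \<open>m D\<close> of \<open>w\<close> on \<open>D\<close> gives a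
      vertex of the simplex over \<open>D\<close>; the scaled vertices add up to a point at which
      \<open>w\<close> takes the value of the Choquet integral.\<close>
    have "\<exists>y\<in>D. w $ y = Max ((\<lambda>y. w $ y) ` D)" if "D \<noteq> {}" for D
      using Max_in[of "(\<lambda>y. w $ y) ` D"] that by fastforce
    then obtain m where m: "\<And>D. D \<noteq> {} \<Longrightarrow> m D \<in> D \<and> w $ m D = Max ((\<lambda>y. w $ y) ` D)"
      by metis
    let ?c = "\<lambda>D. n D *\<^sub>R axis (m D) (1::real)"
    have "w \<bullet> (\<chi> y. p y) \<le> (\<Sum>D | D \<noteq> {}. n D * Max ((\<lambda>y. w $ y) ` D))"
      using expectation_le_Choquet[OF dom tot, of "\<lambda>y. w $ y"] by (simp add: inner_vec_sum_mult)
    also have "\<dots> = w \<bullet> (\<Sum>D | D \<noteq> {}. ?c D)"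
      using m by (auto simp: inner_sum_right inner_axis intro!: sum.cong)
    finally show "\<exists>c. (\<forall>D\<in>{D. D \<noteq> {}}. c D \<in> (\<lambda>h. n D *\<^sub>R h) ` H D) \<and>
        w \<bullet> (\<chi> y. p y) \<le> w \<bullet> (\<Sum>D | D \<noteq> {}. c D)"
      using m by (intro exI[of _ ?c]) (auto simp: H_def intro!: imageI hull_inc)
  qed simp
  then obtain c where c: "\<And>D. D \<noteq> {} \<Longrightarrow> \<exists>h. h \<in> H D \<and> c D = n D *\<^sub>R h"
    and p: "(\<chi> y. p y) = (\<Sum>D | D \<noteq> {}. c D)" by blast
  from c obtain h where h: "\<And>D. D \<noteq> {} \<Longrightarrow> h D \<in> H D \<and> c D = n D *\<^sub>R h D" by metis
  have hs: "(\<forall>y. 0 \<le> h D $ y) \<and> (\<Sum>y\<in>UNIV. h D $ y) = 1 \<and> (\<forall>y. y \<notin> D \<longrightarrow> h D $ y = 0)"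
    if "D \<noteq> {}" for D
    using h[OF that] hull_axis_subset_simplex[of D] unfolding H_def by blast
  \<comment> \<open>At \<open>D = {}\<close> the vector \<open>h D\<close> is unconstrained, and
    \<open>\<kappa> {}\<close> is an unspecified \<open>pmf\<close>; it is still a probability
    measure, so a kernel built from \<open>\<kappa>\<close> is one everywhere.\<close>
  define \<kappa> where "\<kappa> D = embed_pmf (\<lambda>y. h D $ y)" for D
  have \<kappa>: "pmf (\<kappa> D) y = h D $ y" if "D \<noteq> {}" for D y
    unfolding \<kappa>_def using hs[OF that]
    by (intro pmf_embed_pmf) (auto simp: nn_integral_count_space_finite)
  show thesis
  proof
    show "set_pmf (\<kappa> D) \<subseteq> D" if "D \<noteq> {}" for D
      using \<kappa>[OF that] hs[OF that] by (auto simp: set_pmf_iff)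
    show "p y = (\<Sum>D | D \<noteq> {}. n D * pmf (\<kappa> D) y)" for y
      using arg_cong[OF p, of "\<lambda>v. v $ y"] h by (simp add: \<kappa>)
  qed
qed

section \<open>Selections from a single random set\<close>

text \<open>Hitting a singleton is membership of its point, so each event that \<open>F\<close>
  equals \<open>D\<close> is a finite Boolean combination of hitting events.\<close>

lemma measurable_correspondence_count_space:
  fixes F :: "'u::topological_space \<Rightarrow> 'y::finite set"
  assumes "measurable_correspondence F"
  shows "F \<in> borel \<rightarrow>\<^sub>M count_space UNIV"
proof -
  have hit[measurable]: "{\<epsilon>. F \<epsilon> \<inter> A \<noteq> {}} \<in> sets borel" for A
    using assms by (simp add: measurable_correspondence_def)
  have "Measurable.pred borel (\<lambda>\<epsilon>. y \<in> F \<epsilon>)" for y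
    using hit[of "{y}"] by (simp add: pred_def)
  then have "Measurable.pred borel (\<lambda>\<epsilon>. \<forall>y. y \<in> F \<epsilon> \<longleftrightarrow> y \<in> D)" for D
    by measurable
  then have "F -` {D} \<inter> space borel \<in> sets borel" for D
    by (simp add: pred_def set_eq_iff[symmetric] vimage_def)
  then show ?thesis
    by (intro measurable_count_space_eq2[THEN iffD2]) auto
qed

lemma integral_finite_valued:
  fixes F :: "'u \<Rightarrow> 'd::finite" and f :: "'d \<Rightarrow> real"
  assumes "prob_space N" and F: "F \<in> N \<rightarrow>\<^sub>M count_space UNIV"
  shows "(\<integral>\<epsilon>. f (F \<epsilon>) \<partial>N) = (\<Sum>D\<in>UNIV. measure N {\<epsilon>\<in>space N. F \<epsilon> = D} * f D)"
proof -
  interpret prob_space N by fact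
  have [measurable]: "{\<epsilon>\<in>space N. F \<epsilon> = D} \<in> sets N" for D
    using measurable_sets[OF F, of "{D}"] by (simp add: vimage_def Int_def conj_commute)
  have "(\<integral>\<epsilon>. f (F \<epsilon>) \<partial>N) =
      (\<integral>\<epsilon>. (\<Sum>D\<in>UNIV. indicator {\<epsilon>\<in>space N. F \<epsilon> = D} \<epsilon> * f D) \<partial>N)"
    by (intro Bochner_Integration.integral_cong)
      (auto simp: indicator_def of_bool_def if_distrib[of "\<lambda>x. x * _"] sum.delta' cong: if_cong)
  also have "\<dots> = (\<Sum>D\<in>UNIV. measure N {\<epsilon>\<in>space N. F \<epsilon> = D} * f D)"
    by (subst Bochner_Integration.integral_sum)
      (auto intro!: integrable_mult_left simp: integrable_indicator_iff emeasure_eq_measure)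
  finally show ?thesis .
qed

text \<open>Where \<open>F \<epsilon>\<close> misses \<open>B\<close>, it already carries all the
  mass of \<open>k \<epsilon>\<close>, leaving none for \<open>B\<close>. Hence the integrand is
  almost everywhere at most the indicator of the hitting event.\<close>

lemma selection_le_hitting_prob:
  fixes F :: "'u::topological_space \<Rightarrow> 'y::finite set"
  assumes "prob_space N" and N: "sets N = sets borel" and F: "measurable_correspondence F"
    and k: "k \<in> borel \<rightarrow>\<^sub>M prob_algebra (count_space UNIV)"
    and supp: "AE \<epsilon> in N. measure (k \<epsilon>) (F \<epsilon>) = 1"
  shows "(\<integral>\<epsilon>. measure (k \<epsilon>) B \<partial>N) \<le> measure N {\<epsilon>. F \<epsilon> \<inter> B \<noteq> {}}"
proof -
  interpret N: prob_space N by fact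
  have kN: "k \<in> N \<rightarrow>\<^sub>M subprob_algebra (count_space UNIV)"
    using k measurable_cong_sets[OF N refl] by (blast intro: measurable_prob_algebraD)
  have meas: "(\<lambda>\<epsilon>. measure (k \<epsilon>) B) \<in> borel_measurable N"
    by (rule measurable_compose[OF kN measurable_measure_subprob_algebra]) simp
  have kp: "prob_space (k \<epsilon>)" "sets (k \<epsilon>) = UNIV" for \<epsilon>
    using measurable_space[OF k, of \<epsilon>] by (auto simp: space_prob_algebra)
  have hit: "{\<epsilon>. F \<epsilon> \<inter> B \<noteq> {}} \<in> sets N"
    using F N by (simp add: measurable_correspondence_def)
  have "(\<integral>\<epsilon>. measure (k \<epsilon>) B \<partial>N) \<le> (\<integral>\<epsilon>. indicator {\<epsilon>. F \<epsilon> \<inter> B \<noteq> {}} \<epsilon> \<partial>N)"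
  proof (rule integral_mono_AE)
    show "integrable N (\<lambda>\<epsilon>. measure (k \<epsilon>) B)"
      using kp by (intro N.integrable_const_bound[where B = 1] meas)
        (auto intro: prob_space.prob_le_1)
    show "integrable N (indicator {\<epsilon>. F \<epsilon> \<inter> B \<noteq> {}} :: _ \<Rightarrow> real)"
      using hit by (simp add: integrable_indicator_iff N.emeasure_eq_measure)
    show "AE \<epsilon> in N. measure (k \<epsilon>) B \<le> indicator {\<epsilon>. F \<epsilon> \<inter> B \<noteq> {}} \<epsilon>"
      using supp
    proof eventually_elim
      case (elim \<epsilon>)
      interpret prob_space "k \<epsilon>" by (rule kp)
      have "measure (k \<epsilon>) B \<le> 1 - measure (k \<epsilon>) (F \<epsilon>)" if "F \<epsilon> \<inter> B = {}"
        using that finite_measure_Union[of "F \<epsilon>" B] prob_le_1[of "F \<epsilon> \<union> B"] by (simp add: kp)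
      then show ?case
        using elim by (auto simp: indicator_def)
    qed
  qed
  also have "\<dots> = measure N {\<epsilon>. F \<epsilon> \<inter> B \<noteq> {}}"
    using hit by simp
  finally show ?thesis .
qed

text \<open>The kernel depends on \<open>\<epsilon>\<close> only through
  \<open>F \<epsilon>\<close>: on each event that \<open>F\<close> equals \<open>D\<close> it is the
  constant measure \<open>\<kappa> D\<close> obtained from \<open>transport_pmf\<close>.\<close>

lemma selection_exists:
  fixes F :: "'u::topological_space \<Rightarrow> 'y::finite set"
  assumes "prob_space N" and N: "sets N = sets borel" and F: "measurable_correspondence F"
    and "prob_space Q" and Q: "sets Q = UNIV"
    and dom: "\<And>B. measure Q B \<le> measure N {\<epsilon>. F \<epsilon> \<inter> B \<noteq> {}}"
  shows "\<exists>k \<in> borel \<rightarrow>\<^sub>M prob_algebra (count_space UNIV).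
    (AE \<epsilon> in N. measure (k \<epsilon>) (F \<epsilon>) = 1) \<and>
    (\<forall>A. measure Q A = (\<integral>\<epsilon>. measure (k \<epsilon>) A \<partial>N))"
proof -
  interpret N: prob_space N by fact
  interpret Q: prob_space Q by fact
  note Fb = measurable_correspondence_count_space[OF F]
  have FN: "F \<in> N \<rightarrow>\<^sub>M count_space UNIV"
    using Fb measurable_cong_sets[OF N refl] by blast
  have sN: "space N = UNIV" using sets_eq_imp_space_eq[OF N] by simp
  have sQ: "space Q = UNIV" using Q sets.sets_into_space[of UNIV Q] by auto
  define n where "n D = measure N {\<epsilon>. F \<epsilon> = D}" for D
  define p where "p y = measure Q {y}" for y
  have lev: "{\<epsilon>. F \<epsilon> \<in> \<D>} \<in> sets N" for \<D>
    using measurable_sets[OF FN, of \<D>] by (simp add: sN vimage_def)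
  have pB: "sum p B = measure Q B" for B
    using Q.finite_measure_finite_Union[of B "\<lambda>y. {y}"]
    by (simp add: p_def Q disjoint_family_on_def)
  have nD: "sum n \<D> = measure N {\<epsilon>. F \<epsilon> \<in> \<D>}" for \<D>
  proof -
    have "measure N (\<Union>D\<in>\<D>. {\<epsilon>. F \<epsilon> = D}) = sum n \<D>"
      unfolding n_def using lev[of "{_}"]
      by (intro N.finite_measure_finite_Union) (auto simp: disjoint_family_on_def)
    moreover have "(\<Union>D\<in>\<D>. {\<epsilon>. F \<epsilon> = D}) = {\<epsilon>. F \<epsilon> \<in> \<D>}" by auto
    ultimately show ?thesis by simp
  qed
  have dom': "sum p B \<le> (\<Sum>D | D \<inter> B \<noteq> {}. n D)" for B
    using dom[of B] by (simp add: pB nD)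
  \<comment> \<open>Domination at \<open>B = UNIV\<close> makes \<open>F\<close> almost surely
    nonempty, which yields both the equality of total masses and \<open>n {} = 0\<close>.\<close>
  have ne: "measure N {\<epsilon>. F \<epsilon> \<noteq> {}} = 1"
    using dom[of UNIV] N.prob_le_1[of "{\<epsilon>. F \<epsilon> \<noteq> {}}"] Q.prob_space by (simp add: sQ antisym)
  have tot: "sum p UNIV = (\<Sum>D | D \<noteq> {}. n D)"
    using ne Q.prob_space by (simp add: pB nD sQ)
  have "n {} = 0"
    using ne N.prob_compl[OF lev[of "{{}}"]] 
    by (simp add: n_def sN Compl_eq_Diff_UNIV[symmetric] Collect_neg_eq)
  have AE_ne: "AE \<epsilon> in N. F \<epsilon> \<noteq> {}"
    using N.AE_prob_1[of "{\<epsilon>. F \<epsilon> \<noteq> {}}"] ne by simp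
  obtain \<kappa> where \<kappa>: "\<And>D. D \<noteq> {} \<Longrightarrow> set_pmf (\<kappa> D) \<subseteq> D"
    and p: "\<And>y. p y = (\<Sum>D | D \<noteq> {}. n D * pmf (\<kappa> D) y)"
    using transport_pmf[of n p, OF _ dom' tot] by (auto simp: n_def)
  \<comment> \<open>The integral over \<open>N\<close> sums over all values of \<open>F\<close>, so
    the term for the empty set is added at no cost.\<close>
  have p': "p y = (\<Sum>D\<in>UNIV. n D * pmf (\<kappa> D) y)" for y
    unfolding p using \<open>n {} = 0\<close> by (intro sum.mono_neutral_left) auto
  show ?thesis
  proof (intro bexI[of _ "\<lambda>\<epsilon>. measure_pmf (\<kappa> (F \<epsilon>))"] conjI allI)
    show "(\<lambda>\<epsilon>. measure_pmf (\<kappa> (F \<epsilon>))) \<in> borel \<rightarrow>\<^sub>M prob_algebra (count_space UNIV)"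
      using Fb by (rule measurable_compose)
        (auto simp: space_prob_algebra intro: prob_space_measure_pmf)
    show "AE \<epsilon> in N. measure_pmf.prob (\<kappa> (F \<epsilon>)) (F \<epsilon>) = 1"
      using AE_ne by eventually_elim (use \<kappa> in \<open>auto simp: measure_pmf.prob_eq_1 AE_measure_pmf_iff\<close>)
    fix A
    have "(\<integral>\<epsilon>. measure_pmf.prob (\<kappa> (F \<epsilon>)) A \<partial>N) = (\<Sum>D\<in>UNIV. n D * measure_pmf.prob (\<kappa> D) A)"
      using integral_finite_valued[OF \<open>prob_space N\<close> FN, of "\<lambda>D. measure_pmf.prob (\<kappa> D) A"]
      by (simp add: n_def sN)
    also have "\<dots> = (\<Sum>y\<in>A. \<Sum>D\<in>UNIV. n D * pmf (\<kappa> D) y)"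
      by (subst sum.swap) (simp add: measure_measure_pmf_finite sum_distrib_left)
    also have "\<dots> = measure Q A" by (simp add: pB flip: p')
    finally show "measure Q A = (\<integral>\<epsilon>. measure_pmf.prob (\<kappa> (F \<epsilon>)) A \<partial>N)" by simp
  qed
qed

section \<open>Submodularity and the value of the minimum\<close>

text \<open>Hitting events turn unions into unions, but a set may hit \<open>A\<close> and
  \<open>B\<close> at different points without hitting \<open>A \<inter> B\<close>; this gives an
  inequality for \<open>N\<close>. The measure \<open>Q\<close> is modular and contributes equally
  to both sides.\<close>

lemma submodular_hitting_diff:
  fixes F :: "'u::topological_space \<Rightarrow> 'y::finite set"
  assumes "prob_space N" and N: "sets N = sets borel" and F: "measurable_correspondence F"
    and "prob_space Q" and Q: "sets Q = UNIV"
  shows "submodular (\<lambda>B. measure N {\<epsilon>. F \<epsilon> \<inter> B \<noteq> {}} - measure Q B)"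
  unfolding submodular_def
proof (intro allI)
  interpret N: prob_space N by fact
  interpret Q: prob_space Q by fact
  fix A B
  let ?H = "\<lambda>B. {\<epsilon>. F \<epsilon> \<inter> B \<noteq> {}}"
  have H: "?H B \<in> sets N" for B
    using F N by (simp add: measurable_correspondence_def)
  have "?H (A \<union> B) = ?H A \<union> ?H B" by auto
  then have "measure N (?H (A \<union> B)) = measure N (?H A) + measure N (?H B) - measure N (?H A \<inter> ?H B)"
    using measure_Un3[of "?H A" N "?H B"] H by (simp add: N.fmeasurable_eq_sets)
  moreover have "measure N (?H (A \<inter> B)) \<le> measure N (?H A \<inter> ?H B)"
    using H by (intro N.finite_measure_mono) auto
  moreover have "measure Q (A \<union> B) = measure Q A + measure Q B - measure Q (A \<inter> B)"
    using measure_Un3[of A Q B] by (simp add: Q.fmeasurable_eq_sets Q)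
  ultimately show "measure N (?H (A \<union> B)) - measure Q (A \<union> B) + (measure N (?H (A \<inter> B)) - measure Q (A \<inter> B))
      \<le> measure N (?H A) - measure Q A + (measure N (?H B) - measure Q B)" by linarith
qed

text \<open>A value \<open>0\<close>, later the one at the empty set, bounds the minimum above by
  \<open>0\<close>, so only nonnegativity remains to be asked.\<close>

lemma Min_range_eq_0_iff:
  fixes f :: "'a::finite \<Rightarrow> real"
  assumes "f a = 0"
  shows "Min (range f) = 0 \<longleftrightarrow> (\<forall>x. 0 \<le> f x)"
proof
  show "Min (range f) = 0 \<Longrightarrow> \<forall>x. 0 \<le> f x"
    by (metis Min_le finite finite_imageI rangeI)
  show "\<forall>x. 0 \<le> f x \<Longrightarrow> Min (range f) = 0"
    using assms by (intro Min_eqI) (auto intro: rev_image_eqI)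
qed

section \<open>From single values of \<open>X\<close> to the identified set\<close>

theorem theorem2:
  fixes M :: "'w measure" and S :: "'x measure"
    and X :: "'w \<Rightarrow> 'x" and Y :: "'w \<Rightarrow> 'y::finite"
    and P :: "'x \<Rightarrow> 'y measure"
    and \<Theta> :: "(real ^ 'd) set"
    and \<nu> :: "'x \<Rightarrow> real ^ 'd \<Rightarrow> 'u::polish_space measure"
    and G :: "'u \<Rightarrow> 'x \<Rightarrow> real ^ 'd \<Rightarrow> 'y set"
  assumes "prob_space M"
    and "X \<in> M \<rightarrow>\<^sub>M S"
    and "Y \<in> M \<rightarrow>\<^sub>M count_space UNIV"
    and "conditional_distribution M S X (count_space UNIV) Y P"
    and "open \<Theta>"
    and "\<And>x \<theta>. x \<in> space S \<Longrightarrow> \<theta> \<in> \<Theta> \<Longrightarrow> prob_space (\<nu> x \<theta>) \<and> sets (\<nu> x \<theta>) = sets borel"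
    and "AE x in distr M S X. \<forall>\<theta>\<in>\<Theta>. measurable_correspondence (\<lambda>\<epsilon>. G \<epsilon> x \<theta>)"
  shows "identified_set (distr M S X) P \<nu> G \<Theta> =
           {\<theta> \<in> \<Theta>. AE x in distr M S X.
              Min ((\<lambda>B. hitting_prob \<nu> G x \<theta> B - measure (P x) B) ` UNIV) = 0}
         \<and> (AE x in distr M S X. \<forall>\<theta>\<in>\<Theta>.
              submodular (\<lambda>B. hitting_prob \<nu> G x \<theta> B - measure (P x) B))"
proof
  let ?\<mu> = "distr M S X"
  have PM: "P \<in> S \<rightarrow>\<^sub>M prob_algebra (count_space UNIV)"
    using assms(4) by (simp add: conditional_distribution_def)
  have P: "prob_space (P x)" "sets (P x) = UNIV" if "x \<in> space S" for x
    using measurable_space[OF PM that] by (auto simp: space_prob_algebra)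
  \<comment> \<open>Membership in \<open>space S\<close> is recorded because \<open>P x\<close> and
    \<open>\<nu> x \<theta>\<close> are known to be probability measures only there.\<close>
  have reg: "AE x in ?\<mu>. x \<in> space S \<and> (\<forall>\<theta>\<in>\<Theta>. measurable_correspondence (\<lambda>\<epsilon>. G \<epsilon> x \<theta>))"
    using assms(7) AE_space[of ?\<mu>] by eventually_elim simp
  show "AE x in ?\<mu>. \<forall>\<theta>\<in>\<Theta>. submodular (\<lambda>B. hitting_prob \<nu> G x \<theta> B - measure (P x) B)"
    using reg
    by eventually_elim (auto simp: hitting_prob_def intro!: submodular_hitting_diff P simp: assms(6))
  have Min_iff: "Min ((\<lambda>B. hitting_prob \<nu> G x \<theta> B - measure (P x) B) ` UNIV) = 0 \<longleftrightarrow>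
      (\<forall>B. measure (P x) B \<le> measure (\<nu> x \<theta>) {\<epsilon>. G \<epsilon> x \<theta> \<inter> B \<noteq> {}})" for x \<theta>
    by (subst Min_range_eq_0_iff[of _ "{}"]) (simp_all add: hitting_prob_def)
  \<comment> \<open>Gathers what both conditions on a mechanism say at one value \<open>x\<close>,
    so that the claim reduces to the existence of \<open>k\<close> for each \<open>x\<close>
    separately.\<close>
  define sel where "sel x \<theta> k \<longleftrightarrow> k \<in> borel \<rightarrow>\<^sub>M prob_algebra (count_space UNIV) \<and>
      (AE \<epsilon> in \<nu> x \<theta>. measure (k \<epsilon>) (G \<epsilon> x \<theta>) = 1) \<and>
      (\<forall>A. measure (P x) A = (\<integral>\<epsilon>. measure (k \<epsilon>) A \<partial>\<nu> x \<theta>))" for x \<theta> k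
  have key: "(\<exists>k. sel x \<theta> k) \<longleftrightarrow>
      Min ((\<lambda>B. hitting_prob \<nu> G x \<theta> B - measure (P x) B) ` UNIV) = 0"
    if x: "x \<in> space S" and \<theta>: "\<theta> \<in> \<Theta>" and m: "measurable_correspondence (\<lambda>\<epsilon>. G \<epsilon> x \<theta>)" for x \<theta>
  proof -
    have \<nu>: "prob_space (\<nu> x \<theta>)" "sets (\<nu> x \<theta>) = sets borel"
      using assms(6)[OF x \<theta>] by auto
    show ?thesis
      unfolding Min_iff
    proof
      assume "\<exists>k. sel x \<theta> k"
      then show "\<forall>B. measure (P x) B \<le> measure (\<nu> x \<theta>) {\<epsilon>. G \<epsilon> x \<theta> \<inter> B \<noteq> {}}"
        using selection_le_hitting_prob[OF \<nu> m] by (auto simp: sel_def)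
    next
      assume "\<forall>B. measure (P x) B \<le> measure (\<nu> x \<theta>) {\<epsilon>. G \<epsilon> x \<theta> \<inter> B \<noteq> {}}"
      then show "\<exists>k. sel x \<theta> k"
        using selection_exists[OF \<nu> m P[OF x]] unfolding sel_def by blast
    qed
  qed
  have sel_iff: "equilibrium_selection_mechanism ?\<mu> \<nu> G \<theta> \<pi> \<and> compatible_with_data ?\<mu> P \<nu> \<theta> \<pi> \<longleftrightarrow>
      (AE x in ?\<mu>. sel x \<theta> (\<pi> x))" for \<theta> \<pi>
    unfolding sel_def equilibrium_selection_mechanism_def compatible_with_data_def
    by (simp only: AE_conj_iff conj_assoc)
  have "(\<exists>\<pi>. equilibrium_selection_mechanism ?\<mu> \<nu> G \<theta> \<pi> \<and> compatible_with_data ?\<mu> P \<nu> \<theta> \<pi>) \<longleftrightarrow>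
      (AE x in ?\<mu>. Min ((\<lambda>B. hitting_prob \<nu> G x \<theta> B - measure (P x) B) ` UNIV) = 0)"
    if \<theta>: "\<theta> \<in> \<Theta>" for \<theta>
  proof
    assume "\<exists>\<pi>. equilibrium_selection_mechanism ?\<mu> \<nu> G \<theta> \<pi> \<and> compatible_with_data ?\<mu> P \<nu> \<theta> \<pi>"
    then obtain \<pi> where "AE x in ?\<mu>. sel x \<theta> (\<pi> x)"
      by (simp only: sel_iff) blast
    with reg show "AE x in ?\<mu>. Min ((\<lambda>B. hitting_prob \<nu> G x \<theta> B - measure (P x) B) ` UNIV) = 0"
      by eventually_elim (metis key \<theta>)
  next
    assume "AE x in ?\<mu>. Min ((\<lambda>B. hitting_prob \<nu> G x \<theta> B - measure (P x) B) ` UNIV) = 0"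
    with reg have ex: "AE x in ?\<mu>. \<exists>k. sel x \<theta> k"
      by eventually_elim (metis key \<theta>)
    \<comment> \<open>A mechanism is a family of kernels in \<open>\<epsilon>\<close> with no
      measurability in \<open>x\<close>, so a kernel may be chosen independently at each
      \<open>x\<close>.\<close>
    define \<pi> where "\<pi> x = (SOME k. sel x \<theta> k)" for x
    from ex have "AE x in ?\<mu>. sel x \<theta> (\<pi> x)"
      unfolding \<pi>_def some_eq_ex .
    then have "equilibrium_selection_mechanism ?\<mu> \<nu> G \<theta> \<pi> \<and> compatible_with_data ?\<mu> P \<nu> \<theta> \<pi>"
      by (simp only: sel_iff)
    then show "\<exists>\<pi>. equilibrium_selection_mechanism ?\<mu> \<nu> G \<theta> \<pi> \<and> compatible_with_data ?\<mu> P \<nu> \<theta> \<pi>"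
      by blast
  qed
  then show "identified_set ?\<mu> P \<nu> G \<Theta> =
      {\<theta> \<in> \<Theta>. AE x in ?\<mu>. Min ((\<lambda>B. hitting_prob \<nu> G x \<theta> B - measure (P x) B) ` UNIV) = 0}"
    by (auto simp: identified_set_def)
qed

end
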